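(* Let $m\ge 1$ be an integer, let $\mathcal H$ be a complex Hilbert space with orthonormal basis $(e_n)_{n\ge 1}$, let $(\omega_n)_{n\ge1}$ be a bounded sequence of complex numbers, and let $T\in\mathcal B(\mathcal H)$ be the weighted shift $Te_n=\omega_n e_{n+1}$ $(n\ge 1)$. Suppose that $T$ is an $m$-partial isometry. Let $Z=\{n\ge 1:\omega_n=0\}$. (a) If $Z=\varnothing$, then $T$ is an $m$-isometry. (b) If $Z\ne\varnothing$, write $Z=\{n_r: r\in I\}$, in which $n_1<n_2<\cdots$ is an increasing sequence (finite, with $I=\{1,2,\dots,s\}$, or infinite, with $I=\mathbb N=\{1,2,\dots\}$). Let $n_0=0$ and for each $r\in I$ let $$\mathcal H_r=\operatorname{span}\{e_{n_{r-1}+1},e_{n_{r-1}+2},\dots,e_{n_r}\}.$$ If $I=\{1,2,\dots,s\}$ is finite, let $\mathcal H_\infty=\overline{\operatorname{span}\{e_{n_s+1},e_{n_s+2},\dots\}}$; if $I=\mathbb N$, omit $\mathcal H_\infty$ in what follows. Then $$\mathcal H=\Big(\bigoplus_{r\in I}\mathcal H_r\Big)\oplus\mathcal H_\infty$$ is an orthogonal decomposition into reducing subspaces for $T$. With respect to this decomposition, $$T=\Big(\bigoplus_{r\in I}N_r\Big)\oplus S,$$ in which each $N_r=T|_{\mathcal H_r}$ is nilpotent of order $d_r=n_r-n_{r-1}$. Moreover, $S=T|_{\mathcal H_\infty}$ is an $m$-isometric weighted shift (with respect to the orthonormal basis $e_{n_s+1},e_{n_s+2},\dots$ of $\mathcal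 H_\infty$), unless $I=\mathbb N$, in which case $S$ is omitted.
   Context: $\mathcal B(\mathcal H)$ denotes the bounded linear operators on $\mathcal H$. For $T\in\mathcal B(\mathcal H)$ and an integer $m\ge1$, let $\beta_m(T)=\sum_{k=0}^m(-1)^{m-k}\binom mk T^{*k}T^k$. $T$ is an $m$-isometry if $\beta_m(T)=0$, and an $m$-partial isometry if $T\beta_m(T)=0$. An operator $N$ is nilpotent of order $d\ge 1$ if $N^d=0$ and $N^{d-1}\ne0$ (with $N^0=I$). A closed subspace is reducing for $T$ if it is invariant under both $T$ and $T^*$. *)

theory Defs
  imports "HOL-Analysis.Analysis" "HOL-Library.Extended_Nat" "HOL-Library.FuncSet"
begin

section \<open>Complex Hilbert spaces\<close>

text \<open>
  The inner product is linear in the first argument. Positive definiteness is contained in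
  \<open>cinner_self\<close>, since the norm is one of class \<open>real_normed_vector\<close>.
\<close>

class complex_inner = real_normed_vector +
  fixes scaleC :: "complex \<Rightarrow> 'a \<Rightarrow> 'a" (infixr "*\<^sub>C" 75)
    and cinner :: "'a \<Rightarrow> 'a \<Rightarrow> complex"
  assumes scaleC_add_right: "c *\<^sub>C (x + y) = c *\<^sub>C x + c *\<^sub>C y"
    and scaleC_add_left: "(b + c) *\<^sub>C x = b *\<^sub>C x + c *\<^sub>C x"
    and scaleC_scaleC: "b *\<^sub>C c *\<^sub>C x = (b * c) *\<^sub>C x"
    and scaleR_scaleC: "scaleR r x = complex_of_real r *\<^sub>C x"
    and cinner_commute: "cinner x y = cnj (cinner y x)"
    and cinner_add_left: "cinner (x + y) z = cinner x z + cinner y z"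
    and cinner_scaleC_left: "cinner (c *\<^sub>C x) y = c * cinner x y"
    and cinner_self: "cinner x x = complex_of_real ((norm x)\<^sup>2)"

class complex_hilbert_space = complex_inner + complete_space

lemma scaleC_one: "1 *\<^sub>C x = (x :: 'a::complex_inner)"
  using scaleR_scaleC[of 1 x] by simp

global_interpretation complex_inner:
  vector_space "scaleC :: complex \<Rightarrow> 'a \<Rightarrow> 'a::complex_inner"
  defines csubspace = complex_inner.subspace
    and cspan = complex_inner.span
  by unfold_locales
    (simp_all add: scaleC_add_right scaleC_add_left scaleC_scaleC scaleC_one)


section \<open>Operators on a closed subspace\<close>

text \<open>
  A closed subspace \<open>M\<close> is regarded as a Hilbert space of its own, so the notions below take
  \<open>M\<close> as a parameter; the whole space is the case \<open>M = UNIV\<close>. Only the values of an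
  operator on \<open>M\<close> matter.
\<close>

definition bounded_operator_on :: "'a::complex_inner set \<Rightarrow> ('a \<Rightarrow> 'a) \<Rightarrow> bool" where
  "bounded_operator_on M A \<longleftrightarrow>
     A ` M \<subseteq> M \<and>
     (\<forall>x\<in>M. \<forall>y\<in>M. A (x + y) = A x + A y) \<and>
     (\<forall>c. \<forall>x\<in>M. A (c *\<^sub>C x) = c *\<^sub>C A x) \<and>
     (\<exists>K. \<forall>x\<in>M. norm (A x) \<le> K * norm x)"

text \<open>
  For a bounded operator on a closed subspace the adjoint exists; extensionality outside
  \<open>M\<close> makes it unique as a total function.
\<close>

definition cadjoint_on :: "'a::complex_inner set \<Rightarrow> ('a \<Rightarrow> 'a) \<Rightarrow> 'a \<Rightarrow> 'a" where
  "cadjoint_on M A =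
     (THE B. B \<in> M \<rightarrow>\<^sub>E M \<and> (\<forall>x\<in>M. \<forall>y\<in>M. cinner (A x) y = cinner x (B y)))"

definition beta_on :: "'a::complex_inner set \<Rightarrow> nat \<Rightarrow> ('a \<Rightarrow> 'a) \<Rightarrow> 'a \<Rightarrow> 'a" where
  "beta_on M m A x =
     (\<Sum>k=0..m. ((-1) ^ (m - k) * of_nat (m choose k)) *\<^sub>C
        ((cadjoint_on M A ^^ k) ((A ^^ k) x)))"

definition m_isometry_on :: "'a::complex_inner set \<Rightarrow> nat \<Rightarrow> ('a \<Rightarrow> 'a) \<Rightarrow> bool" where
  "m_isometry_on M m A \<longleftrightarrow> (\<forall>x\<in>M. beta_on M m A x = 0)"

definition m_partial_isometry_on :: "'a::complex_inner set \<Rightarrow> nat \<Rightarrow> ('a \<Rightarrow> 'a) \<Rightarrow> bool" where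
  "m_partial_isometry_on M m A \<longleftrightarrow> (\<forall>x\<in>M. A (beta_on M m A x) = 0)"

definition nilpotent_of_order_on :: "'a::complex_inner set \<Rightarrow> nat \<Rightarrow> ('a \<Rightarrow> 'a) \<Rightarrow> bool" where
  "nilpotent_of_order_on M d A \<longleftrightarrow>
     d \<ge> 1 \<and> (\<forall>x\<in>M. (A ^^ d) x = 0) \<and> (\<exists>x\<in>M. (A ^^ (d - 1)) x \<noteq> 0)"

definition reducing :: "('a::complex_inner \<Rightarrow> 'a) \<Rightarrow> 'a set \<Rightarrow> bool" where
  "reducing T M \<longleftrightarrow>
     csubspace M \<and> closed M \<and> T ` M \<subseteq> M \<and> cadjoint_on UNIV T ` M \<subseteq> M"


section \<open>Weighted shifts\<close>

text \<open>Sequences are indexed from 1; their values at 0 are irrelevant.\<close>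

definition orthonormal_basis_on :: "'a::complex_inner set \<Rightarrow> (nat \<Rightarrow> 'a) \<Rightarrow> bool" where
  "orthonormal_basis_on M e \<longleftrightarrow>
     (\<forall>i\<ge>1. \<forall>j\<ge>1. cinner (e i) (e j) = (if i = j then 1 else 0)) \<and>
     closure (cspan (e ` {1..})) = M"

definition weighted_shift_on ::
  "'a::complex_inner set \<Rightarrow> (nat \<Rightarrow> 'a) \<Rightarrow> (nat \<Rightarrow> complex) \<Rightarrow> ('a \<Rightarrow> 'a) \<Rightarrow> bool" where
  "weighted_shift_on M e \<omega> A \<longleftrightarrow>
     orthonormal_basis_on M e \<and> bounded (\<omega> ` {1..}) \<and> bounded_operator_on M A \<and>
     (\<forall>n\<ge>1. A (e n) = \<omega> n *\<^sub>C e (n + 1))"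


section \<open>Orthogonal direct sums\<close>

definition orthogonal_decomposition :: "'i set \<Rightarrow> ('i \<Rightarrow> 'a::complex_inner set) \<Rightarrow> bool" where
  "orthogonal_decomposition J M \<longleftrightarrow>
     (\<forall>i\<in>J. csubspace (M i) \<and> closed (M i)) \<and>
     (\<forall>i\<in>J. \<forall>j\<in>J. i \<noteq> j \<longrightarrow> (\<forall>x\<in>M i. \<forall>y\<in>M j. cinner x y = 0)) \<and>
     (\<forall>v. \<exists>x. (\<forall>i\<in>J. x i \<in> M i) \<and> (x has_sum v) J)"

definition operator_direct_sum ::
  "'i set \<Rightarrow> ('i \<Rightarrow> 'a::complex_inner set) \<Rightarrow> ('i \<Rightarrow> 'a \<Rightarrow> 'a) \<Rightarrow> ('a \<Rightarrow> 'a) \<Rightarrow> bool" where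
  "operator_direct_sum J M A T \<longleftrightarrow>
     orthogonal_decomposition J M \<and>
     (\<forall>i\<in>J. bounded_operator_on (M i) (A i)) \<and>
     (\<forall>x v. (\<forall>i\<in>J. x i \<in> M i) \<and> (x has_sum v) J \<longrightarrow>
        ((\<lambda>i. A i (x i)) has_sum T v) J)"


section \<open>The decomposition determined by the zero weights\<close>

definition zero_set :: "(nat \<Rightarrow> complex) \<Rightarrow> nat set" where
  "zero_set \<omega> = {n. n \<ge> 1 \<and> \<omega> n = 0}"

definition zero_indices :: "(nat \<Rightarrow> complex) \<Rightarrow> nat set" where
  "zero_indices \<omega> = (if finite (zero_set \<omega>) then {1..card (zero_set \<omega>)} else {1..})"

text \<open>
  The elements of the zero set in increasing order, preceded by 0. The library function
  \<open>enumerate\<close> counts from 0; on a finite set it is used only below the cardinality.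
\<close>

definition zero_enum :: "(nat \<Rightarrow> complex) \<Rightarrow> nat \<Rightarrow> nat" where
  "zero_enum \<omega> r = (if r = 0 then 0 else enumerate (zero_set \<omega>) (r - 1))"

lemma zero_enum_zero: "zero_enum \<omega> 0 = 0"
  by (simp add: zero_enum_def)

lemma zero_enum_image: "zero_enum \<omega> ` zero_indices \<omega> = zero_set \<omega>"
proof (cases "finite (zero_set \<omega>)")
  case True
  have "zero_enum \<omega> ` {1..card (zero_set \<omega>)} =
      enumerate (zero_set \<omega>) ` {..<card (zero_set \<omega>)}"
    unfolding image_Suc_lessThan[symmetric] image_image by (simp add: zero_enum_def)
  also have "\<dots> = zero_set \<omega>"
    using bij_betw_imp_surj_on[OF finite_bij_enumerate[OF True]] .
  finally show ?thesis using True by (simp add: zero_indices_def)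
next
  case False
  have "{1..} = Suc ` UNIV"
    by (auto simp: image_iff Suc_le_eq gr0_conv_Suc)
  then have "zero_enum \<omega> ` {1..} = range (enumerate (zero_set \<omega>))"
    by (simp only: image_image) (simp add: zero_enum_def)
  then show ?thesis using False range_enumerate by (simp add: zero_indices_def)
qed

lemma zero_enum_strict_mono: "strict_mono_on (zero_indices \<omega>) (zero_enum \<omega>)"
proof (rule strict_mono_onI)
  fix r q assume "r \<in> zero_indices \<omega>" "q \<in> zero_indices \<omega>" "r < q"
  then show "zero_enum \<omega> r < zero_enum \<omega> q"
    by (cases "finite (zero_set \<omega>)")
      (auto simp: zero_indices_def zero_enum_def finite_enumerate_mono enumerate_mono)
qed

text \<open>The index \<open>\<infinity>\<close> belongs to the last summand, present only for a finite zero set.\<close>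

definition block_indices :: "(nat \<Rightarrow> complex) \<Rightarrow> enat set" where
  "block_indices \<omega> =
     enat ` zero_indices \<omega> \<union> (if finite (zero_set \<omega>) then {\<infinity>} else {})"

definition block :: "(nat \<Rightarrow> 'a::complex_inner) \<Rightarrow> (nat \<Rightarrow> complex) \<Rightarrow> enat \<Rightarrow> 'a set" where
  "block e \<omega> i =
     (case i of
        enat r \<Rightarrow> cspan (e ` {zero_enum \<omega> (r - 1) + 1..zero_enum \<omega> r})
      | \<infinity> \<Rightarrow> closure (cspan (e ` {zero_enum \<omega> (card (zero_set \<omega>)) + 1..})))"

end

theory Submission
  imports Defs
begin

text \<open>
  Since \<open>T\<close> sends \<open>e\<^sub>n\<close> to a multiple of \<open>e\<^bsub>n+1\<^esub>\<close> and its adjoint goes back, \<open>\<beta>\<^sub>m(T)\<close> is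
  diagonal: \<open>\<beta>\<^sub>m(T) e\<^sub>n = c\<^sub>n e\<^sub>n\<close>. Hence \<open>0 = T \<beta>\<^sub>m(T) e\<^sub>n = c\<^sub>n \<omega>\<^sub>n e\<^bsub>n+1\<^esub>\<close>, so \<open>c\<^sub>n = 0\<close> wherever
  \<open>\<omega>\<^sub>n \<noteq> 0\<close>, and by density \<open>\<beta>\<^sub>m(T)\<close> vanishes on the closed span of any set of such \<open>e\<^sub>n\<close>.
  The zero weights cut the basis into blocks that neither \<open>T\<close> nor its adjoint leaves; on a
  reducing subspace \<open>\<beta>\<^sub>m\<close> of the restriction is the restriction of \<open>\<beta>\<^sub>m(T)\<close>. The adjoint itself is
  \<open>y \<mapsto> \<Sum>\<^sub>n \<langle>y, T e\<^sub>n\<rangle> e\<^sub>n\<close>, which converges because the finite subsums have norm at most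
  \<open>\<parallel>T\<parallel> \<parallel>y\<parallel>\<close>.
\<close>

section \<open>Complex inner product spaces\<close>

lemma cinner_add_right: "cinner x (y + z) = cinner x y + cinner x (z :: 'a::complex_inner)"
  by (metis cinner_add_left cinner_commute complex_cnj_add)

lemma cinner_scaleC_right: "cinner x (c *\<^sub>C y) = cnj c * cinner x (y :: 'a::complex_inner)"
  by (metis cinner_commute cinner_scaleC_left complex_cnj_mult)

lemma cinner_minus_left: "cinner (- x) y = - cinner x (y :: 'a::complex_inner)"
  using cinner_scaleC_left[of "-1" x y] by (simp add: complex_inner.scale_minus_left)

lemma cinner_minus_right: "cinner x (- y) = - cinner x (y :: 'a::complex_inner)"
  using cinner_scaleC_right[of x "-1" y] by (simp add: complex_inner.scale_minus_left)

lemma cinner_diff_left: "cinner (x - y) z = cinner x z - cinner y (z :: 'a::complex_inner)"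
  by (simp only: diff_conv_add_uminus cinner_add_left cinner_minus_left)

lemma cinner_diff_right: "cinner x (y - z) = cinner x y - cinner x (z :: 'a::complex_inner)"
  by (simp only: diff_conv_add_uminus cinner_add_right cinner_minus_right)

lemma cinner_zero_left [simp]: "cinner 0 y = 0"
  using cinner_diff_left[of 0 0 y] by simp

lemma cinner_zero_right [simp]: "cinner y 0 = 0"
  using cinner_diff_right[of y 0 0] by simp

lemma cinner_sum_left: "cinner (\<Sum>i\<in>F. f i) y = (\<Sum>i\<in>F. cinner (f i) y)"
  by (induction F rule: infinite_finite_induct) (auto simp: cinner_add_left)

lemma cinner_sum_right: "cinner y (\<Sum>i\<in>F. f i) = (\<Sum>i\<in>F. cinner y (f i))"
  by (induction F rule: infinite_finite_induct) (auto simp: cinner_add_right)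

lemma norm_scaleC: "norm (c *\<^sub>C x) = cmod c * norm (x :: 'a::complex_inner)"
proof -
  have "complex_of_real ((norm (c *\<^sub>C x))\<^sup>2) = (c * cnj c) * cinner x x"
    by (simp only: cinner_self[symmetric] cinner_scaleC_left cinner_scaleC_right mult_ac)
  also have "\<dots> = complex_of_real ((cmod c * norm x)\<^sup>2)"
    by (simp add: cinner_self complex_norm_square[symmetric] power_mult_distrib)
  finally have "(norm (c *\<^sub>C x))\<^sup>2 = (cmod c * norm x)\<^sup>2"
    by (simp only: of_real_eq_iff)
  then show ?thesis
    by (simp add: power2_eq_iff_nonneg)
qed

lemma cinner_eqI:
  assumes "\<And>x. cinner x y = cinner x z"
  shows "y = (z :: 'a::complex_inner)"
proof -
  have "cinner (y - z) (y - z) = 0"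
    using assms[of "y - z"] by (simp add: cinner_diff_right)
  then show ?thesis
    by (simp add: cinner_self)
qed

lemma pythagoras:
  assumes "cinner x y = 0"
  shows "(norm (x + y))\<^sup>2 = (norm x)\<^sup>2 + (norm (y :: 'a::complex_inner))\<^sup>2"
proof -
  have "cinner y x = 0"
    using assms by (subst cinner_commute) simp
  then have "cinner (x + y) (x + y) = cinner x x + cinner y y"
    using assms by (simp add: cinner_add_left cinner_add_right)
  then have "complex_of_real ((norm (x + y))\<^sup>2) = complex_of_real ((norm x)\<^sup>2 + (norm y)\<^sup>2)"
    by (simp add: cinner_self)
  then show ?thesis
    by (simp only: of_real_eq_iff)
qed

lemma cauchy_schwarz: "cmod (cinner x y) \<le> norm x * norm (y :: 'a::complex_inner)"
proof (cases "y = 0")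
  case False
  define c where "c = cinner x y / cinner y y"
  have yy: "cinner y y \<noteq> 0"
    using False by (simp add: cinner_self)
  \<comment> \<open>\<open>c\<close> is chosen so that \<open>c *\<^sub>C y\<close> is the
    orthogonal projection of \<open>x\<close> onto the line through \<open>y\<close>; by Pythagoras
    it is no longer than \<open>x\<close>.\<close>
  have "cinner (x - c *\<^sub>C y) (c *\<^sub>C y) = 0"
    using yy by (simp add: c_def cinner_diff_left cinner_scaleC_left cinner_scaleC_right)
  from pythagoras[OF this] have "(norm (c *\<^sub>C y))\<^sup>2 \<le> (norm x)\<^sup>2"
    by simp
  then have "norm (c *\<^sub>C y) \<le> norm x"
    by (rule power2_le_imp_le) simp
  moreover have "cmod c * (norm y)\<^sup>2 = cmod (cinner x y)"
    using False by (simp add: c_def cinner_self norm_divide norm_power)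
  ultimately show ?thesis
    using mult_right_mono[of "cmod c * norm y" "norm x" "norm y"]
    by (simp add: norm_scaleC power2_eq_square mult.assoc)
qed simp

lemma bounded_linear_cinner_left: "bounded_linear (\<lambda>x. cinner x (y :: 'a::complex_inner))"
proof (rule bounded_linear_intro)
  show "norm (cinner x y) \<le> norm x * norm y" for x
    by (rule cauchy_schwarz)
qed (simp_all add: cinner_add_left scaleR_scaleC cinner_scaleC_left scaleR_conv_of_real)

text \<open>Conjugate linearity in the second argument is compatible with this, as
  \<open>bounded_linear\<close> speaks of real scalars.\<close>

lemma bounded_linear_cinner_right: "bounded_linear (\<lambda>y. cinner (x :: 'a::complex_inner) y)"
proof (rule bounded_linear_intro)
  show "norm (cinner x y) \<le> norm y * norm x" for y
    using cauchy_schwarz[of x y] by (simp add: mult.commute)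
qed (simp_all add: cinner_add_right scaleR_scaleC cinner_scaleC_right scaleR_conv_of_real)

lemma bounded_linear_scaleC: "bounded_linear (\<lambda>x :: 'a::complex_inner. c *\<^sub>C x)"
proof (rule bounded_linear_intro)
  show "norm (c *\<^sub>C x) \<le> norm x * cmod c" for x :: 'a
    by (simp add: norm_scaleC)
qed (simp_all add: scaleC_add_right scaleR_scaleC scaleC_scaleC mult.commute)


section \<open>Closed subspaces\<close>

lemma csubspace_closure:
  fixes M :: "'a::complex_inner set"
  assumes "csubspace M"
  shows "csubspace (closure M)"
proof (rule complex_inner.subspaceI)
  show "0 \<in> closure M"
    using complex_inner.subspace_0[OF assms] closure_subset by blast
  show "x + y \<in> closure M" if x: "x \<in> closure M" and y: "y \<in> closure M" for x y
  proof -
    obtain f where f: "\<And>n. f n \<in> M" "f \<longlonglongrightarrow> x"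
      using x by (auto simp: closure_sequential)
    obtain g where g: "\<And>n. g n \<in> M" "g \<longlonglongrightarrow> y"
      using y by (auto simp: closure_sequential)
    have "(\<lambda>n. f n + g n) \<longlonglongrightarrow> x + y"
      by (intro tendsto_add f g)
    moreover have "f n + g n \<in> M" for n
      using f(1) g(1) by (rule complex_inner.subspace_add[OF assms])
    ultimately show ?thesis
      by (auto simp: closure_sequential intro!: exI[of _ "\<lambda>n. f n + g n"])
  qed
  show "c *\<^sub>C x \<in> closure M" if x: "x \<in> closure M" for c x
  proof -
    obtain f where f: "\<And>n. f n \<in> M" "f \<longlonglongrightarrow> x"
      using x by (auto simp: closure_sequential)
    have "(\<lambda>n. c *\<^sub>C f n) \<longlonglongrightarrow> c *\<^sub>C x"
      by (rule bounded_linear.tendsto[OF bounded_linear_scaleC]) (rule f)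
    moreover have "c *\<^sub>C f n \<in> M" for n
      using f(1) by (rule complex_inner.subspace_scale[OF assms])
    ultimately show ?thesis
      by (auto simp: closure_sequential intro!: exI[of _ "\<lambda>n. c *\<^sub>C f n"])
  qed
qed

lemma csubspace_closure_cspan: "csubspace (closure (cspan S))"
  by (intro csubspace_closure complex_inner.subspace_span)

lemma closure_cspan_superset: "S \<subseteq> closure (cspan S)"
  using complex_inner.span_superset closure_subset by blast

lemma closure_cspan_minimal:
  assumes "S \<subseteq> M" "csubspace M" "closed M"
  shows "closure (cspan S) \<subseteq> M"
  using assms by (intro closure_minimal complex_inner.span_minimal)

lemma csubspace_cinner_left_zero: "csubspace {x. cinner x (y :: 'a::complex_inner) = 0}"
  by (rule complex_inner.subspaceI) (auto simp: cinner_add_left cinner_scaleC_left)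

lemma csubspace_cinner_right_zero: "csubspace {y. cinner x (y :: 'a::complex_inner) = 0}"
  by (rule complex_inner.subspaceI) (auto simp: cinner_add_right cinner_scaleC_right)

text \<open>The vectors orthogonal to a fixed one form a closed subspace, so orthogonality passes
  from generators to closed spans, one argument at a time.\<close>

lemma closure_cspan_orthogonal:
  fixes A B :: "'a::complex_inner set"
  assumes orth: "\<And>a b. a \<in> A \<Longrightarrow> b \<in> B \<Longrightarrow> cinner a b = 0"
    and x: "x \<in> closure (cspan A)" and y: "y \<in> closure (cspan B)"
  shows "cinner x y = 0"
proof -
  have left: "closed {x. cinner x z = 0}" for z :: 'a
    by (intro closed_Collect_eq linear_continuous_on bounded_linear_cinner_left continuous_on_const)
  have right: "closed {z. cinner x z = 0}" for x :: 'a
    by (intro closed_Collect_eq linear_continuous_on bounded_linear_cinner_right continuous_on_const)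
  have "closure (cspan A) \<subseteq> {x. cinner x b = 0}" if "b \<in> B" for b
    using that orth by (intro closure_cspan_minimal csubspace_cinner_left_zero left) auto
  then have "closure (cspan B) \<subseteq> {y. cinner x y = 0}"
    using x by (intro closure_cspan_minimal csubspace_cinner_right_zero right) auto
  with y show ?thesis
    by auto
qed


section \<open>Expansion with respect to an orthonormal family\<close>

text \<open>Orthonormality is separated from density and allows any index set, so that it passes to
  a single block of the basis.\<close>

definition orthonormal_on :: "'i set \<Rightarrow> ('i \<Rightarrow> 'a::complex_inner) \<Rightarrow> bool" where
  "orthonormal_on I e \<longleftrightarrow> (\<forall>i\<in>I. \<forall>j\<in>I. cinner (e i) (e j) = (if i = j then 1 else 0))"

lemma orthonormal_on_subset: "orthonormal_on I e \<Longrightarrow> J \<subseteq> I \<Longrightarrow> orthonormal_on J e"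
  unfolding orthonormal_on_def by blast

lemma cinner_orthonormal_sum:
  assumes "orthonormal_on I e" "finite F" "F \<subseteq> I" "k \<in> F"
  shows "cinner (\<Sum>i\<in>F. a i *\<^sub>C e i) (e k) = a k"
proof -
  have "cinner (\<Sum>i\<in>F. a i *\<^sub>C e i) (e k) = (\<Sum>i\<in>F. if i = k then a i else 0)"
    unfolding cinner_sum_left
    using assms by (intro sum.cong) (auto simp: cinner_scaleC_left orthonormal_on_def subset_iff)
  then show ?thesis
    using assms by simp
qed

lemma norm_orthonormal_sum:
  assumes "orthonormal_on I e" "finite F" "F \<subseteq> I"
  shows "(norm (\<Sum>i\<in>F. a i *\<^sub>C e i))\<^sup>2 = (\<Sum>i\<in>F. (cmod (a i))\<^sup>2)"
proof -
  have "complex_of_real ((norm (\<Sum>i\<in>F. a i *\<^sub>C e i))\<^sup>2)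
      = (\<Sum>k\<in>F. cnj (a k) * cinner (\<Sum>i\<in>F. a i *\<^sub>C e i) (e k))"
    by (simp only: cinner_self[symmetric] cinner_sum_right cinner_scaleC_right)
  also have "\<dots> = (\<Sum>k\<in>F. cnj (a k) * a k)"
    using assms by (intro sum.cong) (auto simp: cinner_orthonormal_sum)
  also have "\<dots> = complex_of_real (\<Sum>k\<in>F. (cmod (a k))\<^sup>2)"
    unfolding of_real_sum by (intro sum.cong refl) (metis complex_norm_square mult.commute)
  finally show ?thesis
    by (simp only: of_real_eq_iff)
qed

text \<open>With \<open>p\<close> the sum of the Fourier terms over \<open>F\<close>, the vector
  \<open>v - p\<close> is orthogonal to the span, so \<open>v - w = (v - p) + (p - w)\<close> is an
  orthogonal splitting.\<close>

lemma orthonormal_best_approximation: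
  assumes "orthonormal_on I e" "finite F" "F \<subseteq> I" "w \<in> cspan (e ` F)"
  shows "norm (v - (\<Sum>i\<in>F. cinner v (e i) *\<^sub>C e i)) \<le> norm (v - w)"
proof -
  define p where "p = (\<Sum>i\<in>F. cinner v (e i) *\<^sub>C e i)"
  have "p \<in> cspan (e ` F)"
    unfolding p_def by (intro complex_inner.span_sum complex_inner.span_scale complex_inner.span_base) auto
  then have diff: "p - w \<in> cspan (e ` F)"
    using assms(4) by (rule complex_inner.span_diff)
  have "cinner (v - p) (e k) = 0" if "k \<in> F" for k
    by (simp add: p_def cinner_diff_left cinner_orthonormal_sum[OF assms(1-3) that])
  then have "cspan (e ` F) \<subseteq> {z. cinner (v - p) z = 0}"
    by (intro complex_inner.span_minimal csubspace_cinner_right_zero) auto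
  with diff have "cinner (v - p) (p - w) = 0"
    by auto
  from pythagoras[OF this] have "(norm (v - p))\<^sup>2 \<le> (norm (v - w))\<^sup>2"
    by simp
  then show ?thesis
    unfolding p_def by (rule power2_le_imp_le) simp
qed

text \<open>Some finite combination \<open>w\<close> is close to \<open>v\<close>. A Fourier sum
  over any finite index set containing the indices of \<open>w\<close> is at least as close, by best
  approximation.\<close>

lemma orthonormal_expansion:
  assumes on: "orthonormal_on I e" and v: "v \<in> closure (cspan (e ` I))"
  shows "((\<lambda>i. cinner v (e i) *\<^sub>C e i) has_sum v) I"
  unfolding has_sum_def tendsto_iff eventually_finite_subsets_at_top
proof (intro allI impI)
  fix r :: real assume "r > 0"
  with v obtain w where w: "w \<in> cspan (e ` I)" "dist w v < r"
    by (auto simp: closure_approachable)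
  \<comment> \<open>A finite combination involves finitely many members of the family;
    \<open>X\<close> collects indices for them.\<close>
  then obtain S where S: "finite S" "S \<subseteq> e ` I" "w \<in> cspan S"
    by (auto simp: complex_inner.span_explicit intro!: complex_inner.span_sum
        complex_inner.span_scale complex_inner.span_base)
  then obtain X where X: "X \<subseteq> I" "finite X" "S = e ` X"
    by (meson finite_subset_image)
  have "dist (\<Sum>i\<in>Y. cinner v (e i) *\<^sub>C e i) v < r" if "finite Y" "X \<subseteq> Y" "Y \<subseteq> I" for Y
  proof -
    have "w \<in> cspan (e ` Y)"
      using S X that complex_inner.span_mono[of "e ` X" "e ` Y"] by blast
    from orthonormal_best_approximation[OF on \<open>finite Y\<close> \<open>Y \<subseteq> I\<close> this, of v] w(2)
    show ?thesis
      by (simp add: dist_norm norm_minus_commute)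
  qed
  with X show "\<exists>X. finite X \<and> X \<subseteq> I \<and> (\<forall>Y. finite Y \<and> X \<subseteq> Y \<and> Y \<subseteq> I \<longrightarrow>
      dist (\<Sum>i\<in>Y. cinner v (e i) *\<^sub>C e i) v < r)"
    by blast
qed

text \<open>Here the Fourier expansion is a finite sum, hence already a member of the span.\<close>

lemma closure_cspan_finite_orthonormal:
  assumes "orthonormal_on I e" "finite I"
  shows "closure (cspan (e ` I)) = cspan (e ` I)"
proof (rule antisym[OF _ closure_subset], rule subsetI)
  fix v assume "v \<in> closure (cspan (e ` I))"
  from orthonormal_expansion[OF assms(1) this] have "v = (\<Sum>i\<in>I. cinner v (e i) *\<^sub>C e i)"
    using assms(2) by (simp add: has_sum_finite_iff)
  also have "\<dots> \<in> cspan (e ` I)"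
    by (intro complex_inner.span_sum complex_inner.span_scale complex_inner.span_base) auto
  finally show "v \<in> cspan (e ` I)" .
qed

lemma has_sum_in_closed_csubspace:
  fixes f :: "'i \<Rightarrow> 'a::complex_inner"
  assumes "(f has_sum v) I" "\<And>i. i \<in> I \<Longrightarrow> f i \<in> M" "csubspace M" "closed M"
  shows "v \<in> M"
proof (rule Lim_in_closed_set[OF \<open>closed M\<close> _ finite_subsets_at_top_neq_bot])
  show "(sum f \<longlongrightarrow> v) (finite_subsets_at_top I)"
    using assms(1) by (simp add: has_sum_def)
  show "\<forall>\<^sub>F F in finite_subsets_at_top I. sum f F \<in> M"
    using assms(2,3) by (intro eventually_finite_subsets_at_top_weakI complex_inner.subspace_sum) auto
qed

lemma complete_UNIV_hilbert: "complete (UNIV :: 'a::complex_hilbert_space set)"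
  by (meson Cauchy_convergent UNIV_I complete_def convergent_def)

text \<open>By Pythagoras, the squared distance of nested partial sums is the difference of the
  partial sums of the squared coefficients; so the net of partial sums is Cauchy, and the space is
  complete.\<close>

lemma orthonormal_square_summable:
  fixes e :: "'i \<Rightarrow> 'a::complex_hilbert_space"
  assumes on: "orthonormal_on I e" and "(\<lambda>i. (cmod (a i))\<^sup>2) summable_on I"
  shows "(\<lambda>i. a i *\<^sub>C e i) summable_on I"
proof -
  define q where "q = (\<lambda>i. (cmod (a i))\<^sup>2)"
  define f where "f = (\<lambda>i. a i *\<^sub>C e i)"
  have q: "(q has_sum infsum q I) I"
    using assms(2) by (simp add: q_def)
  have "cauchy_filter (filtermap (sum f) (finite_subsets_at_top I))"
    unfolding cauchy_filter_metric_filtermap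
  proof (intro allI impI)
    fix r :: real assume r: "r > 0"
    \<comment> \<open>The radius is squared because the scalar sums control squared norms, and
      halved because two partial sums are compared through \<open>sum f X\<close>.\<close>
    have "\<forall>\<^sub>F F in finite_subsets_at_top I. dist (sum q F) (infsum q I) < (r / 2)\<^sup>2"
      using q r unfolding has_sum_def tendsto_iff by simp
    then obtain X where X: "finite X" "X \<subseteq> I" "dist (sum q X) (infsum q I) < (r / 2)\<^sup>2"
      unfolding eventually_finite_subsets_at_top by blast
    have close: "dist (sum f Y) (sum f X) < r / 2" if Y: "finite Y" "X \<subseteq> Y" "Y \<subseteq> I" for Y
    proof -
      have "(norm (sum f Y - sum f X))\<^sup>2 = (norm (sum f (Y - X)))\<^sup>2"
        using Y X by (simp add: sum_diff)
      also have "\<dots> = sum q (Y - X)"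
        unfolding f_def q_def using Y by (intro norm_orthonormal_sum[OF on]) auto
      also have "\<dots> = sum q Y - sum q X"
        using Y X by (simp add: sum_diff)
      also have "sum q Y \<le> infsum q I"
        using Y assms(2) by (intro finite_sum_le_infsum) (auto simp: q_def)
      also have "infsum q I - sum q X < (r / 2)\<^sup>2"
        using X(3) by (simp add: dist_real_def)
      finally have "(norm (sum f Y - sum f X))\<^sup>2 < (r / 2)\<^sup>2"
        by simp
      then have "norm (sum f Y - sum f X) < r / 2"
        by (rule power2_less_imp_less) (use r in simp)
      then show ?thesis
        by (simp only: dist_norm)
    qed
    have "dist (sum f Y) (sum f Z) < r"
      if "dist (sum f Y) (sum f X) < r / 2" "dist (sum f Z) (sum f X) < r / 2" for Y Z
      using that by (rule dist_triangle_half_l)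
    moreover have "\<forall>\<^sub>F Y in finite_subsets_at_top I. dist (sum f Y) (sum f X) < r / 2"
      using X close unfolding eventually_finite_subsets_at_top by blast
    ultimately show "\<exists>P. eventually P (finite_subsets_at_top I) \<and>
        (\<forall>Y Z. P Y \<and> P Z \<longrightarrow> dist (sum f Y) (sum f Z) < r)"
      by blast
  qed
  then obtain v where "(sum f \<longlongrightarrow> v) (finite_subsets_at_top I)"
    using complete_uniform[where S = UNIV] complete_UNIV_hilbert by (force simp add: filterlim_def)
  then show ?thesis
    unfolding f_def summable_on_def has_sum_def by blast
qed


section \<open>Bounded operators and their adjoints\<close>

text \<open>Gives access to the theory of \<open>bounded_linear\<close>; that notion is real-linear,
  so complex homogeneity stays as a separate conjunct.\<close>

lemma bounded_operator_on_UNIV_iff: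
  "bounded_operator_on UNIV T \<longleftrightarrow> bounded_linear T \<and> (\<forall>c x. T (c *\<^sub>C x) = c *\<^sub>C T x)"
proof
  assume T: "bounded_operator_on UNIV T"
  then obtain K where K: "\<And>x. norm (T x) \<le> K * norm x"
    by (auto simp: bounded_operator_on_def)
  have "bounded_linear T"
    by (rule bounded_linear_intro[where K = K])
      (use T K in \<open>auto simp: bounded_operator_on_def scaleR_scaleC mult.commute\<close>)
  with T show "bounded_linear T \<and> (\<forall>c x. T (c *\<^sub>C x) = c *\<^sub>C T x)"
    by (simp add: bounded_operator_on_def)
next
  assume T: "bounded_linear T \<and> (\<forall>c x. T (c *\<^sub>C x) = c *\<^sub>C T x)"
  then interpret bounded_linear T by simp
  obtain K where "\<And>x. norm (T x) \<le> norm x * K"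
    using bounded by blast
  then have "\<exists>K. \<forall>x. norm (T x) \<le> K * norm x"
    by (auto simp: mult.commute)
  with T show "bounded_operator_on UNIV T"
    by (auto simp: bounded_operator_on_def add)
qed

lemma csubspace_vimage_closed:
  assumes T: "bounded_operator_on UNIV T" and M: "csubspace M" "closed M"
  shows "csubspace (T -` M)" and "closed (T -` M)"
proof -
  have T': "bounded_linear T" "\<And>c x. T (c *\<^sub>C x) = c *\<^sub>C T x"
    using T by (auto simp: bounded_operator_on_UNIV_iff)
  interpret bounded_linear T by fact
  show "csubspace (T -` M)"
    by (rule complex_inner.subspaceI) (auto simp: zero add T' complex_inner.subspace_0[OF M(1)]
        complex_inner.subspace_add[OF M(1)] complex_inner.subspace_scale[OF M(1)])
  show "closed (T -` M)"
    using M(2) by (intro closed_vimage linear_continuous_on T') auto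
qed

text \<open>The preimage of a closed subspace is a closed subspace, so only generators have to be
  checked. This serves for invariance of blocks and, with target \<open>{0}\<close>, for vanishing
  on a closed span.\<close>

lemma bounded_operator_maps_closure_cspan:
  assumes T: "bounded_operator_on UNIV T" and M: "csubspace M" "closed M"
    and "\<And>i. i \<in> I \<Longrightarrow> T (e i) \<in> M" "x \<in> closure (cspan (e ` I))"
  shows "T x \<in> M"
  using closure_cspan_minimal[OF _ csubspace_vimage_closed[OF T M], of "e ` I"] assms(4,5) by auto

lemma bounded_operator_zero_closure_cspan:
  assumes "bounded_operator_on UNIV T" "\<And>i. i \<in> I \<Longrightarrow> T (e i) = 0" "x \<in> closure (cspan (e ` I))"
  shows "T x = 0"
  using bounded_operator_maps_closure_cspan[OF assms(1), of "{0}" I e x] assms(2,3)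
    complex_inner.subspace_single_0 by auto

lemma bounded_operator_on_funpow:
  assumes "bounded_operator_on UNIV T"
  shows "bounded_operator_on UNIV (T ^^ k)"
proof (induction k)
  case 0
  show ?case
    by (auto simp: bounded_operator_on_UNIV_iff id_def bounded_linear_ident)
next
  case (Suc k)
  with assms show ?case
    by (auto simp: bounded_operator_on_UNIV_iff o_def intro: bounded_linear_compose)
qed

lemma bounded_operator_on_restrict:
  assumes "bounded_operator_on UNIV T" "T ` M \<subseteq> M" "csubspace M"
  shows "bounded_operator_on M (restrict T M)"
  using assms complex_inner.subspace_add[OF assms(3)] complex_inner.subspace_scale[OF assms(3)]
  unfolding bounded_operator_on_def by auto

lemma funpow_in_invariant: "A ` M \<subseteq> M \<Longrightarrow> x \<in> M \<Longrightarrow> (A ^^ k) x \<in> M"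
  by (induction k) auto

lemma funpow_restrict:
  "A ` M \<subseteq> M \<Longrightarrow> x \<in> M \<Longrightarrow> (restrict A M ^^ k) x = (A ^^ k) x"
  by (induction k) (auto simp: funpow_in_invariant)

text \<open>The values of two candidates at a point of \<open>M\<close> differ by a vector that lies
  in \<open>M\<close> and is orthogonal to \<open>M\<close>, hence by 0; outside \<open>M\<close>
  extensionality decides.\<close>

lemma cadjoint_on_eqI:
  assumes "csubspace M" "B \<in> M \<rightarrow>\<^sub>E M"
    "\<And>x y. x \<in> M \<Longrightarrow> y \<in> M \<Longrightarrow> cinner (A x) y = cinner x (B y)"
  shows "cadjoint_on M A = B"
  unfolding cadjoint_on_def
proof (rule the_equality)
  show "B \<in> M \<rightarrow>\<^sub>E M \<and> (\<forall>x\<in>M. \<forall>y\<in>M. cinner (A x) y = cinner x (B y))"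
    using assms by blast
next
  fix C assume C: "C \<in> M \<rightarrow>\<^sub>E M \<and> (\<forall>x\<in>M. \<forall>y\<in>M. cinner (A x) y = cinner x (C y))"
  show "C = B"
  proof (rule PiE_ext)
    fix y assume y: "y \<in> M"
    then have "C y \<in> M" "B y \<in> M"
      using C assms(2) by auto
    then have d: "C y - B y \<in> M"
      by (rule complex_inner.subspace_diff[OF assms(1)])
    then have "cinner (C y - B y) (C y) = cinner (C y - B y) (B y)"
      using C assms(3) y by metis
    then have "cinner (C y - B y) (C y - B y) = 0"
      by (simp add: cinner_diff_right)
    then show "C y = B y"
      by (simp add: cinner_self)
  qed (use C assms(2) in auto)
qed

text \<open>Existence: exhibiting one map with the adjoint identity shows that the description in
  \<open>cadjoint_on\<close> really denotes the adjoint.\<close>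

lemma cinner_cadjoint:
  fixes e :: "nat \<Rightarrow> 'a::complex_hilbert_space" and T :: "'a \<Rightarrow> 'a"
  assumes basis: "orthonormal_basis_on UNIV e" and T: "bounded_operator_on UNIV T"
  shows "cinner (T x) y = cinner x (cadjoint_on UNIV T y)"
proof -
  have on: "orthonormal_on {1..} e" and dense: "closure (cspan (e ` {1..})) = UNIV"
    using basis by (auto simp: orthonormal_basis_on_def orthonormal_on_def)
  have T': "bounded_linear T" "\<And>c x. T (c *\<^sub>C x) = c *\<^sub>C T x"
    using T by (auto simp: bounded_operator_on_UNIV_iff)
  interpret bounded_linear T by fact
  obtain K where K: "\<And>x. norm (T x) \<le> K * norm x"
    using T by (auto simp: bounded_operator_on_def)
  define B where "B y = (\<Sum>\<^sub>\<infinity>n\<in>{1..}. cinner y (T (e n)) *\<^sub>C e n)" for y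
  have B: "((\<lambda>n. cinner y (T (e n)) *\<^sub>C e n) has_sum B y) {1..}" for y
  proof -
    have bound: "(\<Sum>n\<in>F. (cmod (cinner y (T (e n))))\<^sup>2) \<le> (norm y * K)\<^sup>2"
      if F: "F \<subseteq> {1..}" "finite F" for F
    proof -
      \<comment> \<open>The partial sum itself is the test vector: the inner product of
        \<open>y\<close> with \<open>T z\<close> is the squared norm of \<open>z\<close>, and
        Cauchy-Schwarz leaves one factor \<open>norm z\<close> to cancel.\<close>
      define z where "z = (\<Sum>n\<in>F. cinner y (T (e n)) *\<^sub>C e n)"
      have "complex_of_real ((norm z)\<^sup>2) = complex_of_real (\<Sum>n\<in>F. (cmod (cinner y (T (e n))))\<^sup>2)"
        unfolding z_def by (simp only: norm_orthonormal_sum[OF on F(2,1)])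
      also have "\<dots> = (\<Sum>n\<in>F. cnj (cinner y (T (e n))) * cinner y (T (e n)))"
        unfolding of_real_sum by (intro sum.cong refl) (metis complex_norm_square mult.commute)
      also have "\<dots> = cinner y (T z)"
        by (simp add: z_def sum T' cinner_sum_right cinner_scaleC_right)
      finally have "(norm z)\<^sup>2 = cmod (cinner y (T z))"
        by (metis abs_power2 norm_of_real)
      also have "\<dots> \<le> norm y * (K * norm z)"
        using cauchy_schwarz[of y "T z"] mult_left_mono[OF K[of z], of "norm y"] by simp
      finally have "norm z * norm z \<le> norm y * K * norm z"
        by (simp add: power2_eq_square mult.assoc)
      then have "norm z \<le> norm y * K" if "z \<noteq> 0"
        using that by simp
      then have "(norm z)\<^sup>2 \<le> (norm y * K)\<^sup>2"
        by (cases "z = 0") (auto intro: power_mono)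
      then show ?thesis
        by (simp add: z_def norm_orthonormal_sum[OF on F(2,1)])
    qed
    have "(\<lambda>n. (cmod (cinner y (T (e n))))\<^sup>2) summable_on {1..}"
      by (rule nonneg_bdd_above_summable_on) (auto intro!: bdd_aboveI2[where M = "(norm y * K)\<^sup>2"] bound)
    then show ?thesis
      unfolding B_def by (intro has_sum_infsum orthonormal_square_summable[OF on])
  qed
  have adj: "cinner (T x) y = cinner x (B y)" for x y
  proof -
    \<comment> \<open>Both sides are continuous and linear in \<open>x\<close>. Written as a
      difference equal to 0, the identity holds on a closed subspace, so the basis vectors
      suffice.\<close>
    have basis_eq: "cinner (T (e k)) y - cinner (e k) (B y) = 0" if k: "k \<in> {1..}" for k
    proof -
      have "((\<lambda>n. cinner (e k) (cinner y (T (e n)) *\<^sub>C e n)) has_sum cinner (e k) (B y)) {1..}"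
        by (rule has_sum_bounded_linear[OF bounded_linear_cinner_right B])
      \<comment> \<open>Only the term at \<open>n = k\<close> survives; its conjugated coefficient
        is the inner product of \<open>T (e k)\<close> with \<open>y\<close>.\<close>
      moreover have "((\<lambda>n. cinner (e k) (cinner y (T (e n)) *\<^sub>C e n)) has_sum cinner (T (e k)) y) {1..}"
        using on k cinner_commute[of "T (e k)" y]
        by (intro has_sum_finite_neutralI[where B = "{k}"])
          (auto simp: cinner_scaleC_right orthonormal_on_def)
      ultimately show ?thesis
        using has_sum_unique by fastforce
    qed
    have "csubspace {x. cinner (T x) y - cinner x (B y) = 0}"
      by (rule complex_inner.subspaceI)
        (auto simp: zero add T' cinner_add_left cinner_scaleC_left)
    moreover have "closed {x. cinner (T x) y - cinner x (B y) = 0}"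
      by (intro closed_Collect_eq continuous_on_diff continuous_on_const linear_continuous_on
          bounded_linear_cinner_left bounded_linear_compose[OF bounded_linear_cinner_left T'(1)])
    ultimately have "closure (cspan (e ` {1..})) \<subseteq> {x. cinner (T x) y - cinner x (B y) = 0}"
      using basis_eq by (intro closure_cspan_minimal) auto
    then show ?thesis
      unfolding dense by auto
  qed
  have "cadjoint_on UNIV T = B"
    by (rule cadjoint_on_eqI) (auto simp: adj)
  then show ?thesis
    by (simp add: adj)
qed

text \<open>Testing the identity with \<open>x = B y\<close> bounds the squared norm of
  \<open>B y\<close> by \<open>K * norm (B y) * norm y\<close>. Linearity follows since a vector is
  determined by its inner products.\<close>

lemma bounded_operator_on_adjoint:
  assumes T: "bounded_operator_on UNIV T" and adj: "\<And>x y. cinner (T x) y = cinner x (B y)"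
  shows "bounded_operator_on UNIV B"
proof -
  obtain K where K: "\<And>x. norm (T x) \<le> K * norm x"
    using T by (auto simp: bounded_operator_on_def)
  have "norm (B y) \<le> K * norm y" for y
  proof (cases "B y = 0")
    case True
    \<comment> \<open>The sign of \<open>K\<close> is not prescribed; it is the bound at
      \<open>y\<close> that makes this product nonnegative.\<close>
    have "0 \<le> K * norm y"
      using K[of y] norm_ge_zero order_trans by blast
    with True show ?thesis by simp
  next
    case False
    have "(norm (B y))\<^sup>2 = cmod (cinner (T (B y)) y)"
      by (simp add: adj cinner_self norm_power)
    also have "\<dots> \<le> (K * norm (B y)) * norm y"
      using cauchy_schwarz[of "T (B y)" y] mult_right_mono[OF K[of "B y"], of "norm y"] by simp
    finally have "norm (B y) * norm (B y) \<le> (K * norm y) * norm (B y)"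
      by (simp add: power2_eq_square mult_ac)
    with False show ?thesis by simp
  qed
  moreover have "B (y + z) = B y + B z" for y z
    by (rule cinner_eqI) (simp only: cinner_add_right adj[symmetric])
  moreover have "B (c *\<^sub>C y) = c *\<^sub>C B y" for c y
    by (rule cinner_eqI) (simp only: cinner_scaleC_right adj[symmetric])
  ultimately show ?thesis
    unfolding bounded_operator_on_def by blast
qed

section \<open>Restriction of the adjoint and of \<open>beta_on\<close> to a reducing
  subspace\<close>

lemma cadjoint_on_restrict:
  assumes adj: "\<And>x y. cinner (T x) y = cinner x (cadjoint_on UNIV T y)" and "reducing T M"
  shows "cadjoint_on M (restrict T M) = restrict (cadjoint_on UNIV T) M"
  \<comment> \<open>The adjoint maps \<open>M\<close> into itself, so its restriction is a candidate
    for the adjoint on \<open>M\<close>, and uniqueness applies.\<close>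
  using assms by (intro cadjoint_on_eqI) (auto simp: reducing_def)

lemma beta_on_restrict:
  assumes adj: "\<And>x y. cinner (T x) y = cinner x (cadjoint_on UNIV T y)" and red: "reducing T M"
    and x: "x \<in> M"
  shows "beta_on M m (restrict T M) x = beta_on UNIV m T x"
proof -
  have inv: "T ` M \<subseteq> M" "cadjoint_on UNIV T ` M \<subseteq> M"
    using red by (auto simp: reducing_def)
  show ?thesis
    using x by (simp add: beta_on_def cadjoint_on_restrict[OF adj red] funpow_restrict
        funpow_in_invariant inv)
qed

text \<open>Linearity and continuity are what let the vanishing of \<open>beta_on UNIV m T\<close>
  spread from basis vectors to their closed span.\<close>

lemma bounded_operator_beta_on:
  assumes T: "bounded_operator_on UNIV T" and adj: "bounded_operator_on UNIV (cadjoint_on UNIV T)"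
  shows "bounded_operator_on UNIV (beta_on UNIV m T)"
proof -
  have pow: "bounded_linear (T ^^ k)" "(T ^^ k) (c *\<^sub>C x) = c *\<^sub>C (T ^^ k) x"
    "bounded_linear (cadjoint_on UNIV T ^^ k)"
    "(cadjoint_on UNIV T ^^ k) (c *\<^sub>C x) = c *\<^sub>C (cadjoint_on UNIV T ^^ k) x" for k c x
    using bounded_operator_on_funpow[OF T, of k] bounded_operator_on_funpow[OF adj, of k]
    by (auto simp: bounded_operator_on_UNIV_iff)
  show ?thesis
    unfolding bounded_operator_on_UNIV_iff
  proof (intro conjI allI)
    show "bounded_linear (beta_on UNIV m T)"
      unfolding beta_on_def
      by (intro bounded_linear_sum bounded_linear_compose[OF bounded_linear_scaleC]
          bounded_linear_compose[OF pow(3) pow(1)])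
    show "beta_on UNIV m T (c *\<^sub>C x) = c *\<^sub>C beta_on UNIV m T x" for c x
      unfolding beta_on_def
      by (simp add: pow complex_inner.scale_sum_right scaleC_scaleC mult.commute)
  qed
qed


section \<open>The partition of the positive integers at the zero weights\<close>

text \<open>The subscripts of the basis vectors generating \<open>block e \<omega> i\<close>;
  questions about the blocks thereby become questions about intervals of integers.\<close>

definition index_block :: "(nat \<Rightarrow> complex) \<Rightarrow> enat \<Rightarrow> nat set" where
  "index_block \<omega> i =
     (case i of
        enat r \<Rightarrow> {zero_enum \<omega> (r - 1) + 1..zero_enum \<omega> r}
      | \<infinity> \<Rightarrow> {zero_enum \<omega> (card (zero_set \<omega>)) + 1..})"

lemma index_block_simps:
  "index_block \<omega> (enat r) = {zero_enum \<omega> (r - 1) + 1..zero_enum \<omega> r}"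
  "index_block \<omega> \<infinity> = {zero_enum \<omega> (card (zero_set \<omega>)) + 1..}"
  by (simp_all add: index_block_def)

lemma index_block_subset: "index_block \<omega> i \<subseteq> {1..}"
  by (cases i) (auto simp: index_block_simps)

text \<open>The index 0 is adjoined because the block of \<open>r\<close> starts after the cut
  number \<open>r - 1\<close>, which is 0 for the first block.\<close>

lemma zero_indices_downward:
  "s \<in> insert 0 (zero_indices \<omega>) \<Longrightarrow> r \<le> s \<Longrightarrow> r \<in> insert 0 (zero_indices \<omega>)"
  by (auto simp: zero_indices_def split: if_splits)

lemma zero_enum_in_zero_set: "r \<in> zero_indices \<omega> \<Longrightarrow> zero_enum \<omega> r \<in> zero_set \<omega>"
  using zero_enum_image by blast

text \<open>Extends \<open>zero_enum_strict_mono\<close> to the artificial cut at 0, which lies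
  below every zero since the zeros are positive.\<close>

lemma zero_enum_less:
  assumes "s \<in> zero_indices \<omega>" "r < s"
  shows "zero_enum \<omega> r < zero_enum \<omega> s"
proof (cases "r = 0")
  case True
  then show ?thesis
    using zero_enum_in_zero_set[OF assms(1)] by (auto simp: zero_enum_zero zero_set_def)
next
  case False
  then have "r \<in> zero_indices \<omega>"
    using zero_indices_downward[of s \<omega> r] assms by auto
  then show ?thesis
    using strict_mono_onD[OF zero_enum_strict_mono] assms by blast
qed

lemma zero_enum_le:
  assumes "s \<in> insert 0 (zero_indices \<omega>)" "r \<le> s"
  shows "zero_enum \<omega> r \<le> zero_enum \<omega> s"
  using assms zero_enum_less[of s \<omega> r] by (cases "r = s") auto

text \<open>The adjoined 0 accounts for an empty zero set, where the last summand starts at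
  \<open>e 1\<close>.\<close>

lemma card_zero_set_in_zero_indices:
  "finite (zero_set \<omega>) \<Longrightarrow> card (zero_set \<omega>) \<in> insert 0 (zero_indices \<omega>)"
  by (auto simp: zero_indices_def Suc_le_eq)

lemma zero_indices_pos: "r \<in> zero_indices \<omega> \<Longrightarrow> 1 \<le> r"
  by (auto simp: zero_indices_def split: if_splits)

text \<open>A zero below cut \<open>r\<close> is cut number \<open>q\<close> for some
  \<open>q < r\<close>, hence is at most cut \<open>r - 1\<close>.\<close>

lemma zero_enum_gap:
  assumes r: "r \<in> zero_indices \<omega>" and n: "zero_enum \<omega> (r - 1) < n" "n < zero_enum \<omega> r"
  shows "\<omega> n \<noteq> 0"
proof
  assume "\<omega> n = 0"
  with n have "n \<in> zero_set \<omega>"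
    by (simp add: zero_set_def)
  then obtain q where q: "q \<in> zero_indices \<omega>" "n = zero_enum \<omega> q"
    using zero_enum_image by blast
  have "q < r"
    using zero_enum_le[of q \<omega> r] q n by fastforce
  then have "zero_enum \<omega> q \<le> zero_enum \<omega> (r - 1)"
    using r zero_indices_downward[of r \<omega> "r - 1"] by (intro zero_enum_le) auto
  with n q show False
    by simp
qed

lemma zero_enum_tail:
  assumes fin: "finite (zero_set \<omega>)" and n: "zero_enum \<omega> (card (zero_set \<omega>)) < n"
  shows "\<omega> n \<noteq> 0"
proof
  assume "\<omega> n = 0"
  with n have "n \<in> zero_set \<omega>"
    by (simp add: zero_set_def)
  then obtain q where q: "q \<in> zero_indices \<omega>" "n = zero_enum \<omega> q"
    using zero_enum_image by blast
  then have "q \<le> card (zero_set \<omega>)"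
    using fin by (simp add: zero_indices_def)
  with zero_enum_le[OF card_zero_set_in_zero_indices[OF fin] this] n q show False
    by simp
qed

lemma block_indices_cases:
  assumes "i \<in> block_indices \<omega>"
  obtains r where "r \<in> zero_indices \<omega>" "i = enat r" | "finite (zero_set \<omega>)" "i = \<infinity>"
  using assms by (auto simp: block_indices_def split: if_splits)

text \<open>A positive \<open>n\<close> lies in the block ending at the first zero not below
  \<open>n\<close>. If there is no such zero, all zeros are below \<open>n\<close>, so they are
  finite in number and \<open>n\<close> lies in the last summand.\<close>

lemma index_block_Union: "(\<Union>i\<in>block_indices \<omega>. index_block \<omega> i) = {1..}"
proof (intro antisym subsetI)
  fix n :: nat assume n: "n \<in> {1..}"
  show "n \<in> (\<Union>i\<in>block_indices \<omega>. index_block \<omega> i)"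
  proof (cases "\<exists>r\<in>zero_indices \<omega>. n \<le> zero_enum \<omega> r")
    case True
    define r where "r = (LEAST r. r \<in> zero_indices \<omega> \<and> n \<le> zero_enum \<omega> r)"
    have r: "r \<in> zero_indices \<omega>" "n \<le> zero_enum \<omega> r"
      using True LeastI_ex[of "\<lambda>r. r \<in> zero_indices \<omega> \<and> n \<le> zero_enum \<omega> r"]
      by (auto simp: r_def)
    \<comment> \<open>Minimality of \<open>r\<close> excludes \<open>r - 1\<close>, unless the
      preceding cut is the artificial one at 0, which is below \<open>n\<close> anyway.\<close>
    have "zero_enum \<omega> (r - 1) < n"
    proof (cases "r - 1 = 0")
      case False
      then have "r - 1 \<in> zero_indices \<omega>"
        using r zero_indices_downward[of r \<omega> "r - 1"] by auto
      moreover have "r - 1 < r"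
        using False by simp
      ultimately show ?thesis
        using not_less_Least[of "r - 1" "\<lambda>r. r \<in> zero_indices \<omega> \<and> n \<le> zero_enum \<omega> r"]
        by (auto simp: r_def[symmetric])
    qed (use n in \<open>simp add: zero_enum_zero\<close>)
    with r have "n \<in> index_block \<omega> (enat r)"
      by (simp add: index_block_simps)
    with r show ?thesis
      by (auto simp: block_indices_def)
  next
    case False
    then have "zero_set \<omega> \<subseteq> {..<n}"
      by (auto simp: zero_enum_image[symmetric] not_le)
    then have fin: "finite (zero_set \<omega>)"
      using finite_subset by blast
    have "zero_enum \<omega> (card (zero_set \<omega>)) < n"
      using card_zero_set_in_zero_indices[OF fin] False n
      by (auto simp: zero_enum_zero not_le)
    then show ?thesis
      using fin by (auto simp: block_indices_def index_block_simps intro!: bexI[of _ \<infinity>])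
  qed
qed (use index_block_subset in blast)

text \<open>By symmetry let the first index be the smaller one. It is then finite, and its block
  ends at a cut that is not beyond the start of the other block; the index \<infinity> comes last in
  the order of \<open>enat\<close>.\<close>

lemma index_block_disjoint:
  assumes "i \<in> block_indices \<omega>" "j \<in> block_indices \<omega>" "i \<noteq> j"
  shows "index_block \<omega> i \<inter> index_block \<omega> j = {}"
proof -
  have less: "index_block \<omega> (enat r) \<inter> index_block \<omega> j = {}"
    if r: "r \<in> zero_indices \<omega>" and j: "j \<in> block_indices \<omega>" "enat r < j" for r j
    using j(1)
  proof (cases rule: block_indices_cases)
    case (1 q)
    then have "zero_enum \<omega> r \<le> zero_enum \<omega> (q - 1)"
      using j(2) zero_indices_downward[of q \<omega> "q - 1"] by (intro zero_enum_le) auto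
    with 1 show ?thesis
      by (auto simp: index_block_simps)
  next
    case 2
    then have "zero_enum \<omega> r \<le> zero_enum \<omega> (card (zero_set \<omega>))"
      using r by (intro zero_enum_le card_zero_set_in_zero_indices) (auto simp: zero_indices_def)
    with 2 show ?thesis
      by (auto simp: index_block_simps)
  qed
  show ?thesis
  proof (cases "i < j")
    case True
    show ?thesis
      using assms(1) by (cases rule: block_indices_cases) (use True assms(2) less[of _ j] in auto)
  next
    case False
    with assms(3) have "j < i"
      by simp
    show ?thesis
      using assms(2) by (cases rule: block_indices_cases) (use \<open>j < i\<close> assms(1) less[of _ i] in auto)
  qed
qed

text \<open>For \<open>T\<close>: a block can be left to the right only at its last subscript, which
  has weight 0. The last summand has no right end.\<close>

lemma index_block_successor:
  assumes "i \<in> block_indices \<omega>" "n \<in> index_block \<omega> i"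
  shows "\<omega> n = 0 \<or> n + 1 \<in> index_block \<omega> i"
  using assms(1)
proof (cases rule: block_indices_cases)
  case (1 r)
  then show ?thesis
    using assms(2) zero_enum_in_zero_set[of r \<omega>]
    by (cases "n = zero_enum \<omega> r") (auto simp: index_block_simps zero_set_def)
qed (use assms(2) in \<open>auto simp: index_block_simps\<close>)

text \<open>For the adjoint: the subscript just before a block is a zero of the weights, or 0, where
  the basis has no vector.\<close>

lemma index_block_predecessor:
  assumes "i \<in> block_indices \<omega>" "n + 1 \<in> index_block \<omega> i"
  shows "n = 0 \<or> \<omega> n = 0 \<or> n \<in> index_block \<omega> i"
proof -
  have start: "zero_enum \<omega> s = 0 \<or> \<omega> (zero_enum \<omega> s) = 0" if "s \<in> insert 0 (zero_indices \<omega>)" for s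
    using that zero_enum_in_zero_set[of s \<omega>] by (auto simp: zero_set_def zero_enum_zero)
  show ?thesis
    using assms(1)
  proof (cases rule: block_indices_cases)
    case (1 r)
    with start[of "r - 1"] zero_indices_downward[of r \<omega> "r - 1"] show ?thesis
      using assms(2) by (cases "n = zero_enum \<omega> (r - 1)") (auto simp: index_block_simps)
  next
    case 2
    with start[OF card_zero_set_in_zero_indices] show ?thesis
      using assms(2) by (cases "n = zero_enum \<omega> (card (zero_set \<omega>))") (auto simp: index_block_simps)
  qed
qed

text \<open>Finite spans are closed, so the finite blocks and the last summand can be treated alike
  as closed spans.\<close>

lemma block_eq_closure_cspan:
  assumes "orthonormal_on {1..} e"
  shows "block e \<omega> i = closure (cspan (e ` index_block \<omega> i))"
  using closure_cspan_finite_orthonormal[OF orthonormal_on_subset[OF assms index_block_subset], of \<omega> i]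
  by (cases i) (auto simp: block_def index_block_simps)


section \<open>Weighted shifts\<close>

locale weighted_shift =
  fixes e :: "nat \<Rightarrow> 'a::complex_hilbert_space"
    and \<omega> :: "nat \<Rightarrow> complex"
    and T :: "'a \<Rightarrow> 'a"
  assumes basis: "orthonormal_basis_on UNIV e"
    and bounded_op: "bounded_operator_on UNIV T"
    and shift: "\<And>n. n \<ge> 1 \<Longrightarrow> T (e n) = \<omega> n *\<^sub>C e (n + 1)"
begin

lemma orthonormal: "orthonormal_on {1..} e"
  using basis by (auto simp: orthonormal_basis_on_def orthonormal_on_def)

lemma dense: "closure (cspan (e ` {1..})) = UNIV"
  using basis by (simp add: orthonormal_basis_on_def)

lemma basis_nonzero: "n \<ge> 1 \<Longrightarrow> e n \<noteq> 0"
  using orthonormal by (force simp: orthonormal_on_def)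

lemma linear_T: "bounded_linear T" "T (c *\<^sub>C x) = c *\<^sub>C T x"
  using bounded_op by (auto simp: bounded_operator_on_UNIV_iff)

abbreviation T_adj :: "'a \<Rightarrow> 'a" where "T_adj \<equiv> cadjoint_on UNIV T"

lemma adj: "cinner (T x) y = cinner x (T_adj y)"
  by (rule cinner_cadjoint[OF basis bounded_op])

lemma bounded_op_adj: "bounded_operator_on UNIV T_adj"
  by (rule bounded_operator_on_adjoint[OF bounded_op adj])

lemma adj_scaleC: "T_adj (c *\<^sub>C x) = c *\<^sub>C T_adj x"
  using bounded_op_adj by (auto simp: bounded_operator_on_UNIV_iff)

text \<open>The difference is orthogonal to the basis, hence to its closed span, which is the whole
  space and contains the difference itself.\<close>

lemma cinner_basis_eqI:
  assumes "\<And>k. k \<ge> 1 \<Longrightarrow> cinner (e k) y = cinner (e k) z"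
  shows "y = z"
proof -
  have "cinner (y - z) (y - z) = 0"
    by (rule closure_cspan_orthogonal[of "e ` {1..}" "{y - z}"])
      (use assms closure_cspan_superset[of "{y - z}"] in \<open>auto simp: dense[simplified] cinner_diff_right\<close>)
  then show ?thesis
    by (simp add: cinner_self)
qed

section \<open>The adjoint as a backward shift, and the diagonal form of
  \<open>beta_on UNIV m T\<close>\<close>

lemma adj_first: "T_adj (e 1) = 0"
proof (rule cinner_basis_eqI)
  fix k :: nat assume k: "k \<ge> 1"
  then have "cinner (e k) (T_adj (e 1)) = \<omega> k * cinner (e (k + 1)) (e 1)"
    by (simp add: adj[symmetric] shift cinner_scaleC_left)
  also have "cinner (e (k + 1)) (e 1) = 0"
    using orthonormal k unfolding orthonormal_on_def by force
  finally show "cinner (e k) (T_adj (e 1)) = cinner (e k) 0"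
    by simp
qed

lemma adj_shift:
  assumes "n \<ge> 1"
  shows "T_adj (e (n + 1)) = cnj (\<omega> n) *\<^sub>C e n"
proof (rule cinner_basis_eqI)
  fix k :: nat assume k: "k \<ge> 1"
  then have "cinner (e k) (T_adj (e (n + 1))) = \<omega> k * cinner (e (k + 1)) (e (n + 1))"
    by (simp add: adj[symmetric] shift cinner_scaleC_left)
  also have "cinner (e (k + 1)) (e (n + 1)) = cinner (e k) (e n)"
    using orthonormal k assms unfolding orthonormal_on_def by auto
  also have "\<omega> k * cinner (e k) (e n) = cinner (e k) (cnj (\<omega> n) *\<^sub>C e n)"
    using orthonormal k assms unfolding orthonormal_on_def by (auto simp: cinner_scaleC_right)
  finally show "cinner (e k) (T_adj (e (n + 1))) = cinner (e k) (cnj (\<omega> n) *\<^sub>C e n)" .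
qed

lemma adj_power_diagonal:
  "n \<ge> 1 \<Longrightarrow> \<exists>c. (T_adj ^^ k) ((T ^^ k) (e n)) = c *\<^sub>C e n"
proof (induction k arbitrary: n)
  case 0
  then show ?case
    by (auto simp: scaleC_one intro: exI[of _ 1])
next
  case (Suc k)
  \<comment> \<open>The innermost \<open>T\<close> and the outermost adjoint are peeled off, so the
    induction hypothesis is used at \<open>n + 1\<close>. Each step multiplies the scalar by the
    squared modulus of \<open>\<omega> n\<close>.\<close>
  obtain c where c: "(T_adj ^^ k) ((T ^^ k) (e (n + 1))) = c *\<^sub>C e (n + 1)"
    using Suc.IH[of "n + 1"] by auto
  have scale: "(T ^^ k) (a *\<^sub>C x) = a *\<^sub>C (T ^^ k) x" "(T_adj ^^ k) (a *\<^sub>C x) = a *\<^sub>C (T_adj ^^ k) x" for a x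
    using bounded_operator_on_funpow[OF bounded_op, of k] bounded_operator_on_funpow[OF bounded_op_adj, of k]
    by (auto simp: bounded_operator_on_UNIV_iff)
  have "(T ^^ Suc k) (e n) = \<omega> n *\<^sub>C (T ^^ k) (e (n + 1))"
    using Suc.prems by (simp add: funpow_swap1 shift scale)
  then have "(T_adj ^^ Suc k) ((T ^^ Suc k) (e n)) = T_adj (\<omega> n *\<^sub>C (c *\<^sub>C e (n + 1)))"
    using c by (simp add: scale)
  also have "\<dots> = (\<omega> n * (c * cnj (\<omega> n))) *\<^sub>C e n"
    using adj_shift[OF Suc.prems] by (simp add: adj_scaleC scaleC_scaleC)
  finally show ?case
    by blast
qed

lemma beta_diagonal:
  assumes "n \<ge> 1"
  shows "\<exists>c. beta_on UNIV m T (e n) = c *\<^sub>C e n"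
proof -
  \<comment> \<open>Choosing the scalars for all \<open>k\<close> at once as a function lets
    \<open>e n\<close> be factored out of the sum.\<close>
  from adj_power_diagonal[OF assms] obtain c
    where c: "\<And>k. (T_adj ^^ k) ((T ^^ k) (e n)) = c k *\<^sub>C e n"
    by metis
  show ?thesis
    by (auto simp: beta_on_def c scaleC_scaleC complex_inner.scale_sum_left[symmetric])
qed

lemma beta_basis_zero:
  assumes "m_partial_isometry_on UNIV m T" "n \<ge> 1" "\<omega> n \<noteq> 0"
  shows "beta_on UNIV m T (e n) = 0"
proof -
  obtain c where c: "beta_on UNIV m T (e n) = c *\<^sub>C e n"
    using beta_diagonal[OF assms(2)] by blast
  then have "(c * \<omega> n) *\<^sub>C e (n + 1) = T (beta_on UNIV m T (e n))"
    using assms(2) by (simp add: linear_T shift scaleC_scaleC)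
  also have "\<dots> = 0"
    using assms(1) by (simp add: m_partial_isometry_on_def)
  finally have "c = 0"
    using assms(3) basis_nonzero[of "n + 1"] by simp
  with c show ?thesis
    by simp
qed

lemma beta_zero_on_closure_cspan:
  assumes "m_partial_isometry_on UNIV m T" "\<And>n. n \<in> A \<Longrightarrow> n \<ge> 1 \<and> \<omega> n \<noteq> 0"
    "x \<in> closure (cspan (e ` A))"
  shows "beta_on UNIV m T x = 0"
  by (rule bounded_operator_zero_closure_cspan[OF bounded_operator_beta_on[OF bounded_op bounded_op_adj]
        _ assms(3)]) (use assms beta_basis_zero in blast)

lemma m_isometry_of_nonzero_weights:
  assumes "m_partial_isometry_on UNIV m T" "zero_set \<omega> = {}"
  shows "m_isometry_on UNIV m T"
  unfolding m_isometry_on_def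
proof
  fix x
  have "x \<in> closure (cspan (e ` {1..}))"
    by (simp only: dense UNIV_I)
  then show "beta_on UNIV m T x = 0"
    using assms by (intro beta_zero_on_closure_cspan[of m "{1..}"]) (auto simp: zero_set_def)
qed

section \<open>The blocks as reducing subspaces\<close>

lemma block_eq: "block e \<omega> i = closure (cspan (e ` index_block \<omega> i))"
  by (rule block_eq_closure_cspan[OF orthonormal])

lemma csubspace_block: "csubspace (block e \<omega> i)"
  unfolding block_eq by (rule csubspace_closure_cspan)

lemma closed_block: "closed (block e \<omega> i)"
  unfolding block_eq by simp

lemma basis_in_block: "n \<in> index_block \<omega> i \<Longrightarrow> e n \<in> block e \<omega> i"
  unfolding block_eq using closure_cspan_superset[of "e ` index_block \<omega> i"] by blast

lemma reducing_block:
  assumes i: "i \<in> block_indices \<omega>"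
  shows "reducing T (block e \<omega> i)"
proof -
  let ?M = "block e \<omega> i"
  \<comment> \<open>Either the next basis vector is still in the block or the weight, and with it
    the image, is 0.\<close>
  have "T (e n) \<in> ?M" if n: "n \<in> index_block \<omega> i" for n
    using index_block_successor[OF i n] index_block_subset n csubspace_block
    by (force simp: shift intro: basis_in_block complex_inner.subspace_scale complex_inner.subspace_0)
  then have "T x \<in> ?M" if "x \<in> ?M" for x
    by (rule bounded_operator_maps_closure_cspan[OF bounded_op csubspace_block closed_block _
          that[unfolded block_eq]])
  moreover have "T_adj (e n) \<in> ?M" if n: "n \<in> index_block \<omega> i" for n
  \<comment> \<open>\<open>e 1\<close> has no predecessor and is killed by the adjoint; otherwise
    the predecessor is in the block or carries weight 0.\<close>
  proof (cases "n = 1")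
    case True
    then show ?thesis
      using adj_first csubspace_block by (simp add: complex_inner.subspace_0)
  next
    case False
    define k where "k = n - 1"
    have k: "n = k + 1" "k \<ge> 1"
      using n index_block_subset[of \<omega> i] False by (auto simp: k_def)
    show ?thesis
      using index_block_predecessor[OF i, of k] n k csubspace_block adj_shift[OF k(2)]
      by (auto intro: basis_in_block complex_inner.subspace_scale complex_inner.subspace_0[OF csubspace_block])
  qed
  then have "T_adj x \<in> ?M" if "x \<in> ?M" for x
    by (rule bounded_operator_maps_closure_cspan[OF bounded_op_adj csubspace_block closed_block _
          that[unfolded block_eq]])
  ultimately show ?thesis
    by (auto simp: reducing_def csubspace_block closed_block)
qed

lemma bounded_operator_on_block:
  "i \<in> block_indices \<omega> \<Longrightarrow> bounded_operator_on (block e \<omega> i) (restrict T (block e \<omega> i))"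
  using reducing_block csubspace_block
  by (intro bounded_operator_on_restrict bounded_op) (auto simp: reducing_def)

section \<open>The orthogonal decomposition and the direct sum of the restrictions\<close>

lemma orthogonal_decomposition_blocks:
  "orthogonal_decomposition (block_indices \<omega>) (block e \<omega>)"
  unfolding orthogonal_decomposition_def
proof (intro conjI ballI impI allI)
  fix i j x y
  assume ij: "i \<in> block_indices \<omega>" "j \<in> block_indices \<omega>" "i \<noteq> j"
    and xy: "x \<in> block e \<omega> i" "y \<in> block e \<omega> j"
  have "cinner (e k) (e l) = 0" if "k \<in> index_block \<omega> i" "l \<in> index_block \<omega> j" for k l
    using that index_block_disjoint[OF ij] index_block_subset orthonormal
    unfolding orthonormal_on_def by (metis disjoint_iff subsetD)
  then show "cinner x y = 0"
    by (intro closure_cspan_orthogonal[OF _ xy[unfolded block_eq]]) blast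
next
  fix v
  \<comment> \<open>The component of \<open>v\<close> in a block is the part of its Fourier series
    with subscripts in that block.\<close>
  define f where "f = (\<lambda>n. cinner v (e n) *\<^sub>C e n)"
  define x where "x i = infsum f (index_block \<omega> i)" for i
  have f: "(f has_sum v) {1..}"
    unfolding f_def by (rule orthonormal_expansion[OF orthonormal]) (simp only: dense UNIV_I)
  have x: "(f has_sum x i) (index_block \<omega> i)" for i
    unfolding x_def
    by (rule has_sum_infsum, rule summable_on_subset_aux[OF complete_UNIV_hilbert _ _ index_block_subset])
      (use f in \<open>auto simp: summable_on_def intro: isUCont_plus\<close>)
  \<comment> \<open>The blocks partition the positive integers, so pairs of a block and a member of
    it correspond bijectively to subscripts; this regroups the Fourier series block by
    block.\<close>
  have "inj_on snd (Sigma (block_indices \<omega>) (index_block \<omega>))"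
    using index_block_disjoint[of _ \<omega>] by (auto simp: inj_on_def)
  moreover have "snd ` Sigma (block_indices \<omega>) (index_block \<omega>) = {1..}"
    by (simp only: snd_image_Sigma index_block_Union)
  ultimately have "((f \<circ> snd) has_sum v) (Sigma (block_indices \<omega>) (index_block \<omega>))"
    using f has_sum_reindex[of snd "Sigma (block_indices \<omega>) (index_block \<omega>)" f v] by simp
  then have "(x has_sum v) (block_indices \<omega>)"
    by (rule has_sum_Sigma[where f = "f \<circ> snd", OF isUCont_plus]) (simp add: x)
  moreover have "x i \<in> block e \<omega> i" for i
    by (rule has_sum_in_closed_csubspace[OF x _ csubspace_block closed_block])
      (auto simp: f_def intro: complex_inner.subspace_scale csubspace_block basis_in_block)
  ultimately show "\<exists>x. (\<forall>i\<in>block_indices \<omega>. x i \<in> block e \<omega> i) \<and> (x has_sum v) (block_indices \<omega>)"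
    by blast
qed (simp_all add: csubspace_block closed_block)

lemma operator_direct_sum_blocks:
  "operator_direct_sum (block_indices \<omega>) (block e \<omega>) (\<lambda>i. restrict T (block e \<omega> i)) T"
  unfolding operator_direct_sum_def
proof (intro conjI ballI allI impI orthogonal_decomposition_blocks bounded_operator_on_block)
  fix x v
  assume x: "(\<forall>i\<in>block_indices \<omega>. x i \<in> block e \<omega> i) \<and> (x has_sum v) (block_indices \<omega>)"
  then have "((\<lambda>i. T (x i)) has_sum T v) (block_indices \<omega>)"
    by (intro has_sum_bounded_linear[OF linear_T(1)]) simp
  then show "((\<lambda>i. restrict T (block e \<omega> i) (x i)) has_sum T v) (block_indices \<omega>)"
    by (rule has_sum_cong[THEN iffD1, rotated]) (use x in auto)
qed

section \<open>Nilpotency on the finite blocks\<close>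

lemma funpow_basis:
  "n \<ge> 1 \<Longrightarrow> (T ^^ k) (e n) = (\<Prod>j<k. \<omega> (n + j)) *\<^sub>C e (n + k)"
  by (induction k) (simp_all add: scaleC_one linear_T shift scaleC_scaleC)

text \<open>\<open>T ^^ k\<close> multiplies by the weights on a window of length \<open>k\<close>.
  A window of length \<open>b - a\<close> starting in the block reaches the zero at
  \<open>b\<close>; the window of length \<open>b - a - 1\<close> from \<open>a + 1\<close> stops
  just before it.\<close>

lemma nilpotent_block:
  assumes r: "r \<in> zero_indices \<omega>"
  shows "nilpotent_of_order_on (block e \<omega> (enat r))
    (zero_enum \<omega> r - zero_enum \<omega> (r - 1)) (restrict T (block e \<omega> (enat r)))"
proof -
  let ?M = "block e \<omega> (enat r)"
  define a where "a = zero_enum \<omega> (r - 1)"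
  define b where "b = zero_enum \<omega> r"
  have ab: "a < b"
    unfolding a_def b_def using zero_indices_pos[OF r] by (intro zero_enum_less r) auto
  have "\<omega> b = 0"
    using zero_enum_in_zero_set[OF r] by (simp add: b_def zero_set_def)
  have "enat r \<in> block_indices \<omega>"
    using r by (simp add: block_indices_def)
  then have inv: "T ` ?M \<subseteq> ?M"
    using reducing_block by (simp add: reducing_def)
  have "(T ^^ (b - a)) (e n) = 0" if n: "n \<in> index_block \<omega> (enat r)" for n
  proof -
    have "n \<ge> 1" "n \<le> b" "a < n"
      using n by (auto simp: index_block_simps a_def b_def)
    \<comment> \<open>The factor at \<open>j = b - n\<close> is the weight at \<open>b\<close>; it
      occurs because \<open>a < n\<close>.\<close>
    then have "(\<Prod>j<b - a. \<omega> (n + j)) = 0"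
      using \<open>\<omega> b = 0\<close> ab by (auto intro!: bexI[of _ "b - n"])
    then show ?thesis
      using \<open>n \<ge> 1\<close> by (simp add: funpow_basis)
  qed
  then have "(T ^^ (b - a)) x = 0" if "x \<in> ?M" for x
    by (rule bounded_operator_zero_closure_cspan[OF bounded_operator_on_funpow[OF bounded_op] _
          that[unfolded block_eq]])
  moreover have "e (a + 1) \<in> ?M"
    using ab by (intro basis_in_block) (simp add: index_block_simps a_def b_def)
  moreover have "(T ^^ (b - a - 1)) (e (a + 1)) \<noteq> 0"
  proof -
    \<comment> \<open>The subscripts run from \<open>a + 1\<close> to \<open>b - 1\<close>, strictly
      between consecutive cuts.\<close>
    have "(\<Prod>j<b - a - 1. \<omega> (a + 1 + j)) \<noteq> 0"
      using zero_enum_gap[OF r] by (auto simp: a_def b_def)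
    then show ?thesis
      by (simp only: funpow_basis) (use basis_nonzero in simp)
  qed
  ultimately show ?thesis
    using ab inv unfolding nilpotent_of_order_on_def a_def[symmetric] b_def[symmetric]
    by (auto simp: funpow_restrict intro!: bexI[of _ "e (a + 1)"])
qed

section \<open>The last summand as an m-isometric weighted shift\<close>

lemma weighted_shift_tail:
  assumes "bounded (\<omega> ` {1..})" and fin: "finite (zero_set \<omega>)"
  defines "N \<equiv> zero_enum \<omega> (card (zero_set \<omega>))"
  shows "weighted_shift_on (block e \<omega> \<infinity>) (\<lambda>j. e (N + j)) (\<lambda>j. \<omega> (N + j))
    (restrict T (block e \<omega> \<infinity>))"
  unfolding weighted_shift_on_def
proof (intro conjI allI impI)
  \<comment> \<open>The shift by \<open>N\<close> makes the basis of the tail start at index 1, as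
    \<open>orthonormal_basis_on\<close> requires.\<close>
  have "(\<lambda>j. e (N + j)) ` {1..} = e ` ((+) N ` {1..})"
    by (simp only: image_image)
  also have "\<dots> = e ` index_block \<omega> \<infinity>"
    by (simp only: index_block_simps N_def image_add_atLeast)
  finally have "(\<lambda>j. e (N + j)) ` {1..} = e ` index_block \<omega> \<infinity>" .
  then show "orthonormal_basis_on (block e \<omega> \<infinity>) (\<lambda>j. e (N + j))"
    using orthonormal by (auto simp: orthonormal_basis_on_def block_eq orthonormal_on_def)
  show "bounded ((\<lambda>j. \<omega> (N + j)) ` {1..})"
    by (rule bounded_subset[OF assms(1)]) auto
  show "bounded_operator_on (block e \<omega> \<infinity>) (restrict T (block e \<omega> \<infinity>))"
    using fin by (intro bounded_operator_on_block) (simp add: block_indices_def)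
  fix n :: nat assume "n \<ge> 1"
  then have "e (N + n) \<in> block e \<omega> \<infinity>"
    by (intro basis_in_block) (simp add: index_block_simps N_def)
  with \<open>n \<ge> 1\<close> show "restrict T (block e \<omega> \<infinity>) (e (N + n)) = \<omega> (N + n) *\<^sub>C e (N + (n + 1))"
    using shift[of "N + n"] by (simp add: add.assoc)
qed

lemma m_isometry_tail:
  assumes "m_partial_isometry_on UNIV m T" and fin: "finite (zero_set \<omega>)"
  shows "m_isometry_on (block e \<omega> \<infinity>) m (restrict T (block e \<omega> \<infinity>))"
  unfolding m_isometry_on_def
proof
  fix x assume x: "x \<in> block e \<omega> \<infinity>"
  have "reducing T (block e \<omega> \<infinity>)"
    using fin by (intro reducing_block) (simp add: block_indices_def)
  then have "beta_on (block e \<omega> \<infinity>) m (restrict T (block e \<omega> \<infinity>)) x = beta_on UNIV m T x"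
    using x by (intro beta_on_restrict adj)
  \<comment> \<open>No weight vanishes beyond the last zero, so every basis vector of the tail is
    annihilated.\<close>
  also have "\<dots> = 0"
    using x zero_enum_tail[OF fin] unfolding block_eq
    by (intro beta_zero_on_closure_cspan[OF assms(1), of "index_block \<omega> \<infinity>"])
      (auto simp: index_block_simps)
  finally show "beta_on (block e \<omega> \<infinity>) m (restrict T (block e \<omega> \<infinity>)) x = 0" .
qed

end

theorem theorem3p3:
  fixes m :: nat
    and e :: "nat \<Rightarrow> 'a::complex_hilbert_space"
    and \<omega> :: "nat \<Rightarrow> complex"
    and T :: "'a \<Rightarrow> 'a"
  assumes "m \<ge> 1"
    and "orthonormal_basis_on UNIV e"
    and "bounded (\<omega> ` {1..})"
    and "bounded_operator_on UNIV T"
    and "\<And>n. n \<ge> 1 \<Longrightarrow> T (e n) = \<omega> n *\<^sub>C e (n + 1)"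
    and "m_partial_isometry_on UNIV m T"
  shows "(zero_set \<omega> = {} \<longrightarrow> m_isometry_on UNIV m T) \<and>
    (zero_set \<omega> \<noteq> {} \<longrightarrow>
      orthogonal_decomposition (block_indices \<omega>) (block e \<omega>) \<and>
      (\<forall>i\<in>block_indices \<omega>. reducing T (block e \<omega> i)) \<and>
      operator_direct_sum (block_indices \<omega>) (block e \<omega>)
        (\<lambda>i. restrict T (block e \<omega> i)) T \<and>
      (\<forall>r\<in>zero_indices \<omega>.
        nilpotent_of_order_on (block e \<omega> (enat r))
          (zero_enum \<omega> r - zero_enum \<omega> (r - 1)) (restrict T (block e \<omega> (enat r)))) \<and>
      (finite (zero_set \<omega>) \<longrightarrow>
        (let s = card (zero_set \<omega>); ns = zero_enum \<omega> s; S = restrict T (block e \<omega> \<infinity>) in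
          weighted_shift_on (block e \<omega> \<infinity>) (\<lambda>j. e (ns + j)) (\<lambda>j. \<omega> (ns + j)) S \<and>
          m_isometry_on (block e \<omega> \<infinity>) m S)))"
proof -
  interpret weighted_shift e \<omega> T
    by unfold_locales (use assms in auto)
  show ?thesis
    unfolding Let_def
    using assms(3,6) m_isometry_of_nonzero_weights orthogonal_decomposition_blocks reducing_block
      operator_direct_sum_blocks nilpotent_block weighted_shift_tail m_isometry_tail
    by blast
qed

end
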